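(* Let $f,g\in C^2[0,1]$, with $g$ monotonically increasing, $g'(x)\neq0$ for $x\in[0,1]$ and $g''(x)\ne0$ for $x\in(0,1)$, and let $\sigma:=\max_{x\in[0,1]}|g'(x)|$. If $\Psi:=(f/g')\circ g^{-1}\in C^{\infty}[g(0),g(1)]$, then there exists a positive constant $c$ such that for all $\kappa>1$ and all $n\in\mathbb{N}$ satisfying $$(n-1)\big(\ln(n-2+e)-1\big)\ge\ln\kappa,$$ one has $$\left|\mathcal{I}_\kappa[f,g]-\mathcal{Q}_{\kappa,n}[f,g]\right|\le c\,\sigma\,(n-2)^{-1/2}\,\kappa^{-n-1}\,\|\Psi\|_{(n-1)n+1}.$$ Moreover, for $n\in\mathbb{N}$ with $n>2$, $\mathcal{N}\big(\mathcal{Q}_{\kappa,n}[f,g]\big)\le\lceil\sigma\rceil\big(n(n-1)\ln n+n^2\big)+1$.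
   Context: $\mathbb{N}=\{1,2,\dots\}$; $\|\cdot\|_\infty$ is the maximum norm; for smooth $\phi$, $\|\phi\|_{k}:=\max\{\|\phi^{(j)}\|_\infty: 0\le j\le k\}$. $\mathcal{I}_\kappa[f,g]:=\int_0^1 f(x)e^{\mathrm{i}\kappa g(x)}\,dx$. Basic Filon-type rule. For $[a,b]\subset[0,1]$ and $m\in\mathbb{N}$, choose (arbitrary) nodes $a=t_0<t_1<\dots<t_m=b$ and let $p_m$ be the polynomial of degree at most $m$ with $p_m(g(t_j))=\Psi(g(t_j))$, $j=0,\dots,m$. Put $\mathcal{Q}^{[a,b]}_{\kappa,m}[f,g]:=\int_{g(a)}^{g(b)}p_m(x)e^{\mathrm{i}\kappa x}\,dx$. For $N\in\mathbb{N}$ let $y_j:=a+(b-a)j/N$, $j=0,\dots,N$, and $\mathcal{Q}^{[a,b]}_{N,\kappa,m}[f,g]:=\sum_{j=1}^{N}\mathcal{Q}^{[y_{j-1},y_j]}_{\kappa,m}[f,g]$. For $n>1$, partition: $x_0=0$, $x_j=\kappa^{(j-1)/(n-1)-1}$ for $j=1,\dots,n$. Put $M_j:=\max\{|g'(x_{j-1})|,|g'(x_j)|\}$, $N_j:=\lceil M_j\rceil$ and $m_j:=\lceil n(n-1)/(n+1-j)\rceil$ for $j=1,\dots,n$. Composite rule: $\mathcal{Q}_{\kappa,n}[f,g]:=\sum_{j=1}^{n}\mathcal{Q}^{[x_{j-1},x_j]}_{N_j,\kappa,m_j}[f,g]$. $\mathcal{N}(F)$ denotes the number of evaluations of $\Psi$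 used in the quadrature formula $F$ (an evaluation at an endpoint shared by two subintervals is counted once). *)

theory Defs
  imports "HOL-Analysis.Analysis" "HOL-Computational_Algebra.Polynomial"
begin

section \<open>Derivatives, smoothness classes and norms on a closed interval\<close>

text \<open>All derivatives are taken relative to the set \<open>S\<close>, so at the endpoints of
  an interval \<open>S = {a..b}\<close> they are one-sided.\<close>

primrec nth_deriv :: "real set \<Rightarrow> nat \<Rightarrow> (real \<Rightarrow> 'a::real_normed_vector) \<Rightarrow> real \<Rightarrow> 'a" where
  "nth_deriv S 0 h = h"
| "nth_deriv S (Suc k) h = (\<lambda>x. vector_derivative (nth_deriv S k h) (at x within S))"

definition C_k_on :: "nat \<Rightarrow> real set \<Rightarrow> (real \<Rightarrow> 'a::real_normed_vector) \<Rightarrow> bool" where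
  "C_k_on k S h \<longleftrightarrow>
     (\<forall>j<k. nth_deriv S j h differentiable_on S) \<and> continuous_on S (nth_deriv S k h)"

definition C_infinity_on :: "real set \<Rightarrow> (real \<Rightarrow> 'a::real_normed_vector) \<Rightarrow> bool" where
  "C_infinity_on S h \<longleftrightarrow> (\<forall>k. C_k_on k S h)"

definition max_norm_on :: "real set \<Rightarrow> (real \<Rightarrow> 'a::real_normed_vector) \<Rightarrow> real" where
  "max_norm_on S h = (SUP x\<in>S. norm (h x))"

definition Ck_norm :: "nat \<Rightarrow> real set \<Rightarrow> (real \<Rightarrow> 'a::real_normed_vector) \<Rightarrow> real" where
  "Ck_norm k S h = Max ((\<lambda>j. max_norm_on S (nth_deriv S j h)) ` {0..k})"


section \<open>The oscillatory integral\<close>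

definition osc_integral :: "real \<Rightarrow> (real \<Rightarrow> complex) \<Rightarrow> (real \<Rightarrow> real) \<Rightarrow> complex" where
  "osc_integral \<kappa> f g = integral {0..1} (\<lambda>x. f x * exp (\<i> * of_real (\<kappa> * g x)))"

definition Psi :: "(real \<Rightarrow> complex) \<Rightarrow> (real \<Rightarrow> real) \<Rightarrow> real \<Rightarrow> complex" where
  "Psi f g = (\<lambda>x. f x / of_real (nth_deriv {0..1} 1 g x)) \<circ> inv_into {0..1} g"


section \<open>The Filon-type rules\<close>

text \<open>A choice of interpolation nodes: \<open>t a b m j\<close> is the \<open>j\<close>-th of the nodes
  selected on the panel \<open>[a,b]\<close> for degree \<open>m\<close>. Distinct panels may carry entirely
  unrelated nodes.\<close>

type_synonym node_choice = "real \<Rightarrow> real \<Rightarrow> nat \<Rightarrow> nat \<Rightarrow> real"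

definition admissible_nodes :: "node_choice \<Rightarrow> bool" where
  "admissible_nodes t \<longleftrightarrow>
     (\<forall>a b m. 0 \<le> a \<and> a < b \<and> b \<le> 1 \<and> 1 \<le> m \<longrightarrow>
        t a b m 0 = a \<and> t a b m m = b \<and> strict_mono_on {0..m} (t a b m))"

definition interp_poly :: "(real \<Rightarrow> complex) \<Rightarrow> nat \<Rightarrow> (nat \<Rightarrow> real) \<Rightarrow> complex poly" where
  "interp_poly \<psi> m z =
     (THE p. degree p \<le> m \<and> (\<forall>j\<le>m. poly p (of_real (z j)) = \<psi> (z j)))"

definition filon ::
  "node_choice \<Rightarrow> real \<Rightarrow> (real \<Rightarrow> complex) \<Rightarrow> (real \<Rightarrow> real) \<Rightarrow> real \<Rightarrow> real \<Rightarrow> nat \<Rightarrow> complex" where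
  "filon t \<kappa> f g a b m =
     integral {g a..g b}
       (\<lambda>x. poly (interp_poly (Psi f g) m (\<lambda>j. g (t a b m j))) (of_real x)
              * exp (\<i> * of_real (\<kappa> * x)))"

definition uniform_pt :: "real \<Rightarrow> real \<Rightarrow> nat \<Rightarrow> nat \<Rightarrow> real" where
  "uniform_pt a b N j = a + (b - a) * real j / real N"

definition filon_uniform ::
  "node_choice \<Rightarrow> real \<Rightarrow> (real \<Rightarrow> complex) \<Rightarrow> (real \<Rightarrow> real) \<Rightarrow> real \<Rightarrow> real \<Rightarrow> nat \<Rightarrow> nat \<Rightarrow> complex" where
  "filon_uniform t \<kappa> f g a b N m =
     (\<Sum>j = 1..N. filon t \<kappa> f g (uniform_pt a b N (j - 1)) (uniform_pt a b N j) m)"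

definition graded_pt :: "real \<Rightarrow> nat \<Rightarrow> nat \<Rightarrow> real" where
  "graded_pt \<kappa> n j =
     (if j = 0 then 0 else \<kappa> powr ((real j - 1) / (real n - 1) - 1))"

definition slope_bound :: "real \<Rightarrow> (real \<Rightarrow> real) \<Rightarrow> nat \<Rightarrow> nat \<Rightarrow> real" where
  "slope_bound \<kappa> g n j =
     max \<bar>nth_deriv {0..1} 1 g (graded_pt \<kappa> n (j - 1))\<bar>
         \<bar>nth_deriv {0..1} 1 g (graded_pt \<kappa> n j)\<bar>"

definition panel_count :: "real \<Rightarrow> (real \<Rightarrow> real) \<Rightarrow> nat \<Rightarrow> nat \<Rightarrow> nat" where
  "panel_count \<kappa> g n j = nat \<lceil>slope_bound \<kappa> g n j\<rceil>"

definition panel_degree :: "nat \<Rightarrow> nat \<Rightarrow> nat" where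
  "panel_degree n j = nat \<lceil>real n * (real n - 1) / (real n + 1 - real j)\<rceil>"

definition composite_filon ::
  "node_choice \<Rightarrow> real \<Rightarrow> nat \<Rightarrow> (real \<Rightarrow> complex) \<Rightarrow> (real \<Rightarrow> real) \<Rightarrow> complex" where
  "composite_filon t \<kappa> n f g =
     (\<Sum>j = 1..n. filon_uniform t \<kappa> f g (graded_pt \<kappa> n (j - 1)) (graded_pt \<kappa> n j)
        (panel_count \<kappa> g n j) (panel_degree n j))"


section \<open>Number of evaluations\<close>

text \<open>The points at which each rule evaluates \<open>Psi f g\<close>. They are collected in a set,
  so an evaluation at an endpoint shared by two panels is counted once.\<close>

definition filon_points :: "node_choice \<Rightarrow> (real \<Rightarrow> real) \<Rightarrow> real \<Rightarrow> real \<Rightarrow> nat \<Rightarrow> real set" where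
  "filon_points t g a b m = (\<lambda>j. g (t a b m j)) ` {0..m}"

definition filon_uniform_points ::
  "node_choice \<Rightarrow> (real \<Rightarrow> real) \<Rightarrow> real \<Rightarrow> real \<Rightarrow> nat \<Rightarrow> nat \<Rightarrow> real set" where
  "filon_uniform_points t g a b N m =
     (\<Union>j\<in>{1..N}. filon_points t g (uniform_pt a b N (j - 1)) (uniform_pt a b N j) m)"

definition composite_filon_points ::
  "node_choice \<Rightarrow> real \<Rightarrow> nat \<Rightarrow> (real \<Rightarrow> real) \<Rightarrow> real set" where
  "composite_filon_points t \<kappa> n g =
     (\<Union>j\<in>{1..n}. filon_uniform_points t g (graded_pt \<kappa> n (j - 1)) (graded_pt \<kappa> n j)
        (panel_count \<kappa> g n j) (panel_degree n j))"

definition num_evals :: "node_choice \<Rightarrow> real \<Rightarrow> nat \<Rightarrow> (real \<Rightarrow> real) \<Rightarrow> nat" where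
  "num_evals t \<kappa> n g = card (composite_filon_points t \<kappa> n g)"

end

(*
  Substituting y = g(x) turns the error on a panel into the integral of r(y) e^(i kappa y) with
  r = Psi - p_m.  Since r vanishes at both ends, one integration by parts gains 1/kappa, and r',
  which by Rolle has m zeros, is at most h^m / m! times the norm of the (m+1)st derivative of
  Psi, where h is the length of the image panel.  As g'' has no zeros, g' is largest at an
  endpoint, so N_j panels make h at most x_j - x_(j-1).  For j >= 2 and q = n + 1 - j this is
  s^(-q) (s - 1) with s = kappa^(1/(n-1)); the choice m_j >= n(n-1)/q turns s^(-q m_j) into
  kappa^(-n), and the condition on n is equivalent to s - 1 <= (n-2)/e, so that
  (s - 1)^m / m! <= m^(-1/2) by Stirling.  For j = 1 the width 1/kappa suffices.  The node
  count reduces to the harmonic number bound H_n <= ln n + 1.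
*)
theory Submission imports Defs begin

section \<open>Factorials and harmonic numbers\<close>

text \<open>A weak Stirling bound. The logarithm of the quotient of the two sides, less the
  correction 1/(4m), does not decrease with m and starts at 3/4.\<close>

lemma fact_ge_sqrt_powr:
  assumes "m \<ge> 1"
  shows "sqrt (real m) * (real m / exp 1) ^ m \<le> fact m"
proof -
  define u where "u = (\<lambda>m::nat. ln (fact m) - (real m + 1/2) * ln (real m) + real m - 1 / (4 * real m))"
  have step: "u m \<le> u (Suc m)" if "m \<ge> 1" for m
  proof -
    \<comment> \<open>The trapezoidal upper bound for ln(m+1) - ln m, multiplied by m + 1/2, exceeds
      1 by exactly the telescoping difference 1/(4m) - 1/(4(m+1)). This dictates the correction term
      in \<open>u\<close>.\<close>
    have "(real m + 1/2) * (ln (real m + 1) - ln (real m))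
        \<le> (real m + 1/2) * ((inverse (real m) + inverse (real m + 1)) / 2)"
      using ln_inverse_approx_le[of "real m" 1] that by (intro mult_left_mono) auto
    also have "\<dots> = 1 + 1 / (4 * real m) - 1 / (4 * (real m + 1))"
      using that by (simp add: divide_simps) (simp add: algebra_simps)
    finally have "(real m + 1/2) * (ln (real m + 1) - ln (real m)) \<le> 1 + 1 / (4 * real m) - 1 / (4 * (real m + 1))" .
    moreover have "ln (fact (Suc m) :: real) = ln (real m + 1) + ln (fact m)"
      by (simp add: ln_mult add.commute)
    ultimately show ?thesis
      by (simp add: u_def algebra_simps)
  qed
  have "u m \<ge> 3/4"
    using assms
  proof (induction m rule: dec_induct)
    case base
    then show ?case by (simp add: u_def)
  next
    case (step m)
    with \<open>\<And>m. m \<ge> 1 \<Longrightarrow> u m \<le> u (Suc m)\<close>[of m] show ?case by simp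
  qed
  moreover have "1 / (4 * real m) \<ge> 0"
    by simp
  ultimately have "ln (fact m) \<ge> (real m + 1/2) * ln (real m) - real m"
    unfolding u_def by linarith
  moreover have "ln (sqrt (real m) * (real m / exp 1) ^ m) = (real m + 1/2) * ln (real m) - real m"
    using assms by (simp add: ln_mult ln_sqrt ln_realpow ln_div algebra_simps)
  ultimately show ?thesis
    using assms by (subst ln_le_cancel_iff[symmetric]) auto
qed

text \<open>Each step adds 1/(n+1), which is absorbed by ln(n+1) - ln n \<ge> 2/(2n+1).\<close>

lemma harm_le_ln_plus_one:
  assumes "n \<ge> 1"
  shows "harm n \<le> ln (real n) + 1"
  using assms
proof (induction n rule: dec_induct)
  case (step n)
  have "inverse (real n + 1) \<le> 2 * (real n + 1 - real n) / (real n + (real n + 1))"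
    by (simp add: divide_simps)
  also have "\<dots> \<le> ln (real n + 1) - ln (real n)"
    using step by (intro ln_inverse_approx_ge) auto
  finally show ?case
    using step by (simp add: harm_Suc add.commute)
qed (simp add: harm_def)

section \<open>Interpolation errors in oscillatory integrals\<close>

text \<open>Induction that adds the largest point y: the mean value theorem yields a zero of
  \<open>h'\<close> strictly between the old maximum and y. The clause \<open>z < Max Z\<close> is
  carried along so that this zero differs from all earlier ones.\<close>

lemma Rolle_finite_set:
  fixes h :: "real \<Rightarrow> real"
  assumes der: "\<And>x. x \<in> {a..b} \<Longrightarrow> (h has_real_derivative h' x) (at x within {a..b})"
    and "finite Z" "Z \<noteq> {}" "Z \<subseteq> {a..b}" "\<And>z. z \<in> Z \<Longrightarrow> h z = 0"
  shows "\<exists>Z' \<subseteq> {Min Z..Max Z}. finite Z' \<and> Suc (card Z') = card Z \<and> (\<forall>z\<in>Z'. h' z = 0 \<and> z < Max Z)"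
  using assms(2-)
proof (induction Z rule: finite_linorder_max_induct)
  case (insert y Z)
  show ?case
  proof (cases "Z = {}")
    case True
    then show ?thesis by (intro exI[of _ "{}"]) auto
  next
    case False
    then obtain Z' where Z': "Z' \<subseteq> {Min Z..Max Z}" "finite Z'" "Suc (card Z') = card Z"
      "\<forall>z\<in>Z'. h' z = 0 \<and> z < Max Z"
      using insert by auto
    have MaxZ: "Max Z \<in> Z" using insert False by auto
    have lt: "Max Z < y" using MaxZ insert by auto
    have sub: "{Max Z..y} \<subseteq> {a..b}" using MaxZ insert.prems by auto
    have d: "(h has_real_derivative h' x) (at x within {Max Z..y})" if "x \<in> {Max Z..y}" for x
      using der[of x] that sub by (blast intro: DERIV_subset)
    obtain x where x: "Max Z < x" "x < y" "h y - h (Max Z) = h' x * (y - Max Z)"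
      using mvt_simple[OF lt, of h "\<lambda>x v. h' x * v"] d
      by (auto simp: has_field_derivative_def)
    have "h y = 0" "h (Max Z) = 0"
      using insert.prems MaxZ by auto
    then have "h' x = 0"
      using x by simp
    moreover have "Max (insert y Z) = y"
      using insert False lt by (subst Max_insert) auto
    moreover have "Min (insert y Z) = Min Z"
      using insert(1) False lt MaxZ Min_le[of Z "Max Z"] by (subst Min_insert) auto
    moreover have "x \<notin> Z'" "y \<notin> Z"
      using Z' x insert by auto
    moreover have "Min Z \<le> Max Z"
      using MaxZ insert.hyps(1) by simp
    moreover have "Suc (card (insert x Z')) = card (insert y Z)"
      using Z' \<open>x \<notin> Z'\<close> \<open>y \<notin> Z\<close> insert.hyps(1) by simp
    ultimately show ?thesis
      using Z'(1,2,4) x(1,2) lt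
      by (intro exI[of _ "insert x Z'"]) (simp only: insert_subset subset_iff, clarsimp, fastforce)
  qed
qed simp

text \<open>\<open>F\<close> lists a function together with its successive derivatives; each
  differentiation costs one of the guaranteed zeros.\<close>

lemma Rolle_iterated:
  fixes F :: "nat \<Rightarrow> real \<Rightarrow> real"
  assumes "\<And>j x. j < k \<Longrightarrow> x \<in> {a..b} \<Longrightarrow> (F j has_real_derivative F (Suc j) x) (at x within {a..b})"
    and "finite Z" "card Z = Suc k" "Z \<subseteq> {a..b}" "\<And>z. z \<in> Z \<Longrightarrow> F 0 z = 0"
  shows "\<exists>x\<in>{a..b}. F k x = 0"
  using assms
proof (induction k arbitrary: F Z)
  case 0
  then show ?case
    by (auto simp: card_1_singleton_iff)
next
  case (Suc k)
  have "Z \<noteq> {}" using Suc.prems by auto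
  then obtain Z' where Z': "Z' \<subseteq> {Min Z..Max Z}" "finite Z'" "Suc (card Z') = card Z"
    "\<forall>z\<in>Z'. F 1 z = 0 \<and> z < Max Z"
    using Rolle_finite_set[of a b "F 0" "F 1" Z] Suc.prems by auto
  have "{Min Z..Max Z} \<subseteq> {a..b}"
    using Suc.prems \<open>Z \<noteq> {}\<close> Min_in[of Z] Max_in[of Z] by fastforce
  then have "Z' \<subseteq> {a..b}"
    using Z' by blast
  then show ?case
    using Suc.IH[of "\<lambda>j. F (Suc j)" Z'] Suc.prems Z' by auto
qed

text \<open>The remainder argument of Lagrange interpolation, with the zero polynomial as
  interpolant. For x outside \<open>Z\<close>, the multiple c of the node polynomial w is chosen so
  that \<open>F 0\<close> - c w also vanishes at x. These m + 1 zeros force a zero y of the m-th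
  derivative, which determines c from \<open>F m y\<close>.\<close>

lemma abs_le_of_zeros:
  fixes F :: "nat \<Rightarrow> real \<Rightarrow> real"
  assumes der: "\<And>j x. j < m \<Longrightarrow> x \<in> {a..b} \<Longrightarrow> (F j has_real_derivative F (Suc j) x) (at x within {a..b})"
    and Z: "finite Z" "card Z = m" "Z \<subseteq> {a..b}" "\<And>z. z \<in> Z \<Longrightarrow> F 0 z = 0"
    and B: "\<And>x. x \<in> {a..b} \<Longrightarrow> \<bar>F m x\<bar> \<le> B"
    and x: "x \<in> {a..b}"
  shows "\<bar>F 0 x\<bar> \<le> B * (b - a) ^ m / fact m"
proof (cases "x \<in> Z")
  case True
  moreover have "B \<ge> 0" using B[OF x] by linarith
  moreover have "b - a \<ge> 0" using x by simp
  ultimately show ?thesis using Z by simp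
next
  case False
  define w :: "real poly" where "w = (\<Prod>z\<in>Z. [:- z, 1:])"
  have poly_w: "poly w y = (\<Prod>z\<in>Z. y - z)" for y
    by (simp add: w_def poly_prod)
  have wx: "poly w x \<noteq> 0"
    using Z False by (auto simp: poly_w)
  define c where "c = F 0 x / poly w x"
  have deg: "degree w = m"
    unfolding w_def using Z by (subst degree_prod_eq_sum_degree) auto
  have lead: "lead_coeff w = 1"
    unfolding w_def by (simp add: lead_coeff_prod)
  \<comment> \<open>As w is monic of degree m, its m-th derivative is the constant m!.\<close>
  obtain l where l: "(pderiv ^^ m) w = [:l:]"
    by (rule degree_eq_zeroE[of "(pderiv ^^ m) w"]) (simp add: degree_higher_pderiv deg)
  moreover have "coeff ((pderiv ^^ m) w) 0 = fact m"
    using lead deg by (simp add: coeff_higher_pderiv pochhammer_fact)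
  ultimately have top: "poly ((pderiv ^^ m) w) y = fact m" for y
    by simp
  have "\<exists>y\<in>{a..b}. F m y - c * poly ((pderiv ^^ m) w) y = 0"
  proof (rule Rolle_iterated[where F = "\<lambda>j y. F j y - c * poly ((pderiv ^^ j) w) y" and Z = "insert x Z"])
    fix j y assume "j < m" "y \<in> {a..b}"
    then show "((\<lambda>y. F j y - c * poly ((pderiv ^^ j) w) y) has_real_derivative
        F (Suc j) y - c * poly ((pderiv ^^ Suc j) w) y) (at y within {a..b})"
      by (intro DERIV_diff DERIV_cmult der) (auto intro: poly_DERIV[THEN DERIV_subset])
  next
    fix z assume "z \<in> insert x Z"
    moreover have "poly w z = 0" if "z \<in> Z"
      using Z(1) that by (auto simp: poly_w)
    ultimately show "F 0 z - c * poly ((pderiv ^^ 0) w) z = 0"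
      using Z(4) wx by (auto simp: c_def)
  qed (use Z False x in auto)
  then obtain y where y: "y \<in> {a..b}" "F m y = c * fact m"
    by (auto simp: top)
  have "\<bar>poly w x\<bar> \<le> (\<Prod>z\<in>Z. b - a)"
    unfolding poly_w abs_prod using Z x by (intro prod_mono) fastforce
  then have wle: "\<bar>poly w x\<bar> \<le> (b - a) ^ m"
    using Z by simp
  have "\<bar>F 0 x\<bar> = \<bar>F m y\<bar> * \<bar>poly w x\<bar> / fact m"
    using y wx by (simp add: c_def abs_mult)
  also have "\<dots> \<le> B * (b - a) ^ m / fact m"
    using B[OF y(1)] wle x by (intro divide_right_mono mult_mono) auto
  finally show ?thesis .
qed

text \<open>Rotating the value of the derivative at \<open>x\<close> onto the positive real axis reduces the
  claim to real functions, for which Rolle's theorem is available.\<close>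

lemma norm_deriv_le_of_zeros:
  fixes R :: "nat \<Rightarrow> real \<Rightarrow> complex"
  assumes der: "\<And>j x. j \<le> m \<Longrightarrow> x \<in> {a..b} \<Longrightarrow> (R j has_vector_derivative R (Suc j) x) (at x within {a..b})"
    and Z: "finite Z" "card Z = Suc m" "Z \<subseteq> {a..b}" "\<And>z. z \<in> Z \<Longrightarrow> R 0 z = 0"
    and B: "\<And>x. x \<in> {a..b} \<Longrightarrow> norm (R (Suc m) x) \<le> B"
    and x: "x \<in> {a..b}"
  shows "norm (R 1 x) \<le> B * (b - a) ^ m / fact m"
proof -
  define u where "u = cnj (sgn (R 1 x))"
  define F where "F = (\<lambda>j y. Re (u * R j y))"
  \<comment> \<open>Only an inequality, since \<open>sgn 0 = 0\<close> makes u vanish when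
    \<open>R 1 x = 0\<close>.\<close>
  have u: "norm u \<le> 1"
    by (simp add: u_def norm_sgn)
  have F_der: "(F j has_real_derivative F (Suc j) y) (at y within {a..b})" if "j \<le> m" "y \<in> {a..b}" for j y
    unfolding F_def has_real_derivative_iff_has_vector_derivative
    using bounded_linear.has_vector_derivative[OF
      bounded_linear_compose[OF bounded_linear_Re bounded_linear_mult_right[of u]] der[OF that]]
    by simp
  \<comment> \<open>One use of Rolle leaves m zeros of \<open>F 1\<close>; the remainder bound is
    then applied to \<open>F 1\<close>, whose m-th derivative is \<open>F (Suc m)\<close>.\<close>
  have "Z \<noteq> {}" using Z by auto
  then obtain Z' where Z': "Z' \<subseteq> {Min Z..Max Z}" "finite Z'" "Suc (card Z') = card Z"
    "\<forall>z\<in>Z'. F 1 z = 0 \<and> z < Max Z"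
    using Rolle_finite_set[of a b "F 0" "F 1" Z] F_der[of 0] Z by (auto simp: F_def)
  have "{Min Z..Max Z} \<subseteq> {a..b}"
    using Z \<open>Z \<noteq> {}\<close> Min_in[of Z] Max_in[of Z] by fastforce
  then have "\<bar>F (Suc 0) x\<bar> \<le> B * (b - a) ^ m / fact m"
  proof (intro abs_le_of_zeros[of m a b "\<lambda>j. F (Suc j)" Z'] F_der x)
    fix y assume "y \<in> {a..b}"
    have "\<bar>F (Suc m) y\<bar> \<le> norm u * norm (R (Suc m) y)"
      unfolding F_def by (metis abs_Re_le_cmod norm_mult)
    also have "\<dots> \<le> 1 * B"
      using u B[OF \<open>y \<in> {a..b}\<close>] by (intro mult_mono) auto
    finally show "\<bar>F (Suc m) y\<bar> \<le> B" by simp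
  qed (use Z' Z in auto)
  moreover have "u * R 1 x = of_real (norm (R 1 x))"
    unfolding u_def by (cases "R 1 x = 0")
      (simp_all add: sgn_div_norm complex_norm_square[symmetric] mult.commute[of "cnj _"]
        power2_eq_square scaleR_conv_of_real field_simps)
  then have "F 1 x = norm (R 1 x)"
    unfolding F_def by (metis Re_complex_of_real)
  ultimately show ?thesis by simp
qed

section \<open>Integration by parts against the oscillating factor\<close>

lemma norm_oscillatory_integral_le:
  fixes r r' :: "real \<Rightarrow> complex" and \<kappa> :: real
  assumes "a \<le> b" "\<kappa> > 0" "r a = 0" "r b = 0"
    and der: "\<And>x. x \<in> {a..b} \<Longrightarrow> (r has_vector_derivative r' x) (at x within {a..b})"
    and bound: "\<And>x. x \<in> {a..b} \<Longrightarrow> norm (r' x) \<le> C"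
  shows "norm (integral {a..b} (\<lambda>x. r x * exp (\<i> * of_real (\<kappa> * x)))) \<le> C * (b - a) / \<kappa>"
proof -
  let ?e = "\<lambda>x. exp (\<i> * of_real (\<kappa> * x)) :: complex"
  have e: "(?e has_vector_derivative (\<i> * of_real \<kappa> * ?e x)) (at x within {a..b})" for x
    by (rule has_vector_derivative_real_field[where f = "\<lambda>z. exp (\<i> * (of_real \<kappa> * z))",
          simplified of_real_mult[symmetric]])
      (auto intro!: derivative_eq_intros simp: algebra_simps)
  have cont: "continuous_on {a..b} r"
    using der by (auto simp: continuous_on_eq_continuous_within intro: has_vector_derivative_continuous[OF der])
  have int: "(\<lambda>x. r x * ?e x) integrable_on {a..b}"
    by (intro integrable_continuous_real continuous_intros cont)
  have "((\<lambda>x. r x * (\<i> * of_real \<kappa> * ?e x) + r' x * ?e x) has_integral (r b * ?e b - r a * ?e a)) {a..b}"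
    using \<open>a \<le> b\<close> by (intro fundamental_theorem_of_calculus has_vector_derivative_mult der e)
  \<comment> \<open>Subtracting the continuous summand yields the integrability of the summand with
    \<open>r'\<close> along with its value; the boundary terms are zero.\<close>
  then have "((\<lambda>x. (r x * (\<i> * of_real \<kappa> * ?e x) + r' x * ?e x) - \<i> * of_real \<kappa> * (r x * ?e x)) has_integral
      (0 - \<i> * of_real \<kappa> * integral {a..b} (\<lambda>x. r x * ?e x))) {a..b}"
    using assms int by (intro has_integral_diff has_integral_mult_right) (auto simp: integrable_integral)
  then have I: "((\<lambda>x. r' x * ?e x) has_integral
      (- (\<i> * of_real \<kappa> * integral {a..b} (\<lambda>x. r x * ?e x)))) {a..b}"
    by (simp add: algebra_simps)
  have "0 \<le> C"
    using bound[of a] \<open>a \<le> b\<close> norm_ge_zero[of "r' a"] by (auto simp del: norm_ge_zero)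
  have "norm (- (\<i> * of_real \<kappa> * integral {a..b} (\<lambda>x. r x * ?e x))) \<le> C * (b - a)"
    using has_integral_bound_real[OF \<open>0 \<le> C\<close> finite.emptyI I] bound assms by (simp add: norm_mult)
  then have "\<kappa> * norm (integral {a..b} (\<lambda>x. r x * ?e x)) \<le> C * (b - a)"
    using assms by (simp add: norm_mult)
  then show ?thesis
    using assms by (simp add: field_simps)
qed

section \<open>Polynomial interpolation\<close>

text \<open>Newton's form: a new node is served by adding a multiple of the product of the X - z_j
  over the old nodes, which leaves the values there unchanged.\<close>

lemma interpolation_poly_exists:
  fixes z w :: "nat \<Rightarrow> 'a::field"
  assumes "inj_on z {..m}"
  shows "\<exists>p. degree p \<le> m \<and> (\<forall>j\<le>m. poly p (z j) = w j)"
  using assms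
proof (induction m)
  case 0
  then show ?case by (intro exI[of _ "[:w 0:]"]) auto
next
  case (Suc m)
  then obtain p where p: "degree p \<le> m" "\<And>j. j \<le> m \<Longrightarrow> poly p (z j) = w j"
    using inj_on_subset[of z "{..Suc m}" "{..m}"] by auto
  define q where "q = (\<Prod>j\<le>m. [:- z j, 1:])"
  have q: "poly q x = (\<Prod>j\<le>m. x - z j)" for x
    by (simp add: q_def poly_prod)
  have qz: "poly q (z j) = 0" if "j \<le> m" for j
    using that by (auto simp: q)
  have q0: "poly q (z (Suc m)) \<noteq> 0"
  proof -
    have "z (Suc m) \<noteq> z j" if "j \<le> m" for j
      using inj_onD[OF Suc.prems, of "Suc m" j] that by auto
    then show ?thesis by (auto simp: q)
  qed
  define c where "c = (w (Suc m) - poly p (z (Suc m))) / poly q (z (Suc m))"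
  have "degree q = Suc m"
    unfolding q_def by (subst degree_prod_eq_sum_degree) auto
  then have "degree (p + smult c q) \<le> Suc m"
    using p(1) by (intro degree_add_le) auto
  moreover have "\<forall>j\<le>Suc m. poly (p + smult c q) (z j) = w j"
    using p(2) qz q0 by (auto simp: c_def le_Suc_eq)
  ultimately show ?case by blast
qed

text \<open>\<open>interp_poly\<close> is a definite description, so uniqueness is needed besides
  existence: two polynomials of degree at most m that agree at m + 1 points coincide.\<close>

lemma interp_poly_correct:
  assumes "inj_on z {0..m}"
  shows "degree (interp_poly \<psi> m z) \<le> m" "\<And>j. j \<le> m \<Longrightarrow> poly (interp_poly \<psi> m z) (of_real (z j)) = \<psi> (z j)"
proof -
  let ?P = "\<lambda>p. degree p \<le> m \<and> (\<forall>j\<le>m. poly p (of_real (z j)) = \<psi> (z j))"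
  let ?z = "\<lambda>j. complex_of_real (z j)"
  have inj: "inj_on ?z {..m}"
    using assms by (auto simp: inj_on_def)
  obtain p where p: "?P p"
    using interpolation_poly_exists[OF inj, of "\<lambda>j. \<psi> (z j)"] by auto
  have "q = p" if "?P q" for q
  proof (rule poly_eqI_degree)
    show "poly q x = poly p x" if "x \<in> ?z ` {..m}" for x
      using \<open>?P q\<close> p that by fastforce
    show "degree q < card (?z ` {..m})" "degree p < card (?z ` {..m})"
      unfolding card_image[OF inj] using \<open>?P q\<close> p by simp_all
  qed
  then have "?P (interp_poly \<psi> m z)"
    unfolding interp_poly_def by (rule theI[of ?P, OF p])
  then show "degree (interp_poly \<psi> m z) \<le> m" "\<And>j. j \<le> m \<Longrightarrow> poly (interp_poly \<psi> m z) (of_real (z j)) = \<psi> (z j)"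
    by auto
qed

section \<open>Derivatives and norms on a compact set\<close>

lemma nth_deriv_has_vector_derivative:
  assumes "C_k_on k S h" "j < k" "x \<in> S"
  shows "(nth_deriv S j h has_vector_derivative nth_deriv S (Suc j) h x) (at x within S)"
  using assms by (auto simp: C_k_on_def differentiable_on_def vector_derivative_works)

text \<open>Compactness makes the set of values bounded, without which the supremum in
  \<open>max_norm_on\<close> carries no information.\<close>

lemma norm_le_max_norm_on:
  assumes "compact S" "continuous_on S h" "x \<in> S"
  shows "norm (h x) \<le> max_norm_on S h"
proof -
  have "compact ((\<lambda>x. norm (h x)) ` S)"
    by (intro compact_continuous_image continuous_on_norm assms)
  then show ?thesis
    unfolding max_norm_on_def using assms
    by (intro cSUP_upper bounded_imp_bdd_above compact_imp_bounded) auto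
qed

lemma norm_nth_deriv_le_Ck_norm:
  assumes "compact S" "C_infinity_on S h" "x \<in> S" "j \<le> k"
  shows "norm (nth_deriv S j h x) \<le> Ck_norm k S h"
proof -
  have "continuous_on S (nth_deriv S j h)"
    using assms by (auto simp: C_infinity_on_def C_k_on_def)
  then have "norm (nth_deriv S j h x) \<le> max_norm_on S (nth_deriv S j h)"
    using assms by (intro norm_le_max_norm_on) auto
  also have "\<dots> \<le> Ck_norm k S h"
    unfolding Ck_norm_def using assms by (intro Max_ge) auto
  finally show ?thesis .
qed

lemma integral_combine_sum:
  fixes F :: "real \<Rightarrow> 'a::banach" and s :: "nat \<Rightarrow> real"
  assumes "F integrable_on {s 0..s N}" "mono_on {0..N} s"
  shows "integral {s 0..s N} F = (\<Sum>k=1..N. integral {s (k - 1)..s k} F)"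
  using assms
proof (induction N)
  case (Suc N)
  have le: "s 0 \<le> s N" "s N \<le> s (Suc N)"
    using Suc.prems by (auto simp: mono_on_def)
  have "F integrable_on {s 0..s N}"
    using Suc.prems(1) by (rule integrable_on_subinterval) (use le in auto)
  moreover have "mono_on {0..N} s"
    using Suc.prems(2) by (auto simp: mono_on_def)
  ultimately show ?case
    using Suc.IH Henstock_Kurzweil_Integration.integral_combine[OF le Suc.prems(1)] by simp
qed simp

declare nth_deriv.simps [simp del]

section \<open>The rule on a uniform partition\<close>

lemma uniform_pt_less: "a < b \<Longrightarrow> i < j \<Longrightarrow> N \<ge> 1 \<Longrightarrow> uniform_pt a b N i < uniform_pt a b N j"
  by (simp add: uniform_pt_def divide_strict_right_mono)

lemma uniform_pt_ends: "uniform_pt a b N 0 = a" "N \<ge> 1 \<Longrightarrow> uniform_pt a b N N = b"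
  by (auto simp: uniform_pt_def)

lemma uniform_pt_mem:
  assumes "a < b" "N \<ge> 1" "j \<le> N"
  shows "uniform_pt a b N j \<in> {a..b}"
  using uniform_pt_less[where a = a and b = b and i = 0 and j = j and N = N]
    uniform_pt_less[where a = a and b = b and i = j and j = N and N = N]
    uniform_pt_ends[where a = a and b = b and N = N] assms
  by (cases "j = 0"; cases "j = N") auto

section \<open>The phase and its derivative\<close>

locale filon_phase =
  fixes f :: "real \<Rightarrow> complex" and g :: "real \<Rightarrow> real"
  assumes g_C2: "C_k_on 2 {0..1} g"
    and g_mono: "mono_on {0..1} g"
    and g'_nonzero: "\<And>x. x \<in> {0..1} \<Longrightarrow> nth_deriv {0..1} 1 g x \<noteq> 0"
    and g''_nonzero: "\<And>x. x \<in> {0<..<1} \<Longrightarrow> nth_deriv {0..1} 2 g x \<noteq> 0"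
    and Psi_smooth: "C_infinity_on {g 0..g 1} (Psi f g)"
begin

abbreviation g' :: "real \<Rightarrow> real" where
  "g' \<equiv> nth_deriv {0..1} 1 g"

abbreviation osc :: "real \<Rightarrow> real \<Rightarrow> complex" where
  "osc \<kappa> \<equiv> (\<lambda>y. Psi f g y * exp (\<i> * of_real (\<kappa> * y)))"

lemma g_has_derivative:
  "x \<in> {0..1} \<Longrightarrow> (g has_real_derivative g' x) (at x within {0..1})"
  using nth_deriv_has_vector_derivative[OF g_C2, of 0 x]
  by (simp add: has_real_derivative_iff_has_vector_derivative nth_deriv.simps(1))

lemma g'_has_derivative:
  "x \<in> {0..1} \<Longrightarrow> (g' has_real_derivative nth_deriv {0..1} 2 g x) (at x within {0..1})"
  using nth_deriv_has_vector_derivative[OF g_C2, of 1 x]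
  by (simp add: has_real_derivative_iff_has_vector_derivative numeral_2_eq_2)

lemma continuous_g': "continuous_on {0..1} g'"
  by (rule DERIV_continuous_on[OF g'_has_derivative])

lemma g_mean_value:
  assumes "0 \<le> a" "a \<le> b" "b \<le> 1"
  shows "\<exists>x\<in>{a..b}. g b - g a = g' x * (b - a)"
proof (rule mvt_very_simple[OF \<open>a \<le> b\<close>])
  fix x assume "a \<le> x" "x \<le> b"
  then show "(g has_derivative (\<lambda>v. g' x * v)) (at x within {a..b})"
    using DERIV_subset[OF g_has_derivative, of x "{a..b}"] assms
    by (simp add: has_field_derivative_def)
qed

text \<open>Monotonicity gives a mean value point z with \<open>g' z \<ge> 0\<close>. A value of
  \<open>g'\<close> at or below 0 elsewhere would force a zero, because the image of the interval
  under the continuous \<open>g'\<close> is connected.\<close>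

lemma g'_pos:
  assumes "x \<in> {0..1}"
  shows "0 < g' x"
proof (rule ccontr)
  assume "\<not> 0 < g' x"
  moreover obtain z where z: "z \<in> {0..1}" "g 1 - g 0 = g' z * (1 - 0)"
    using g_mean_value[of 0 1] by auto
  moreover have "g 0 \<le> g 1"
    using g_mono by (auto simp: mono_on_def)
  ultimately have "0 \<in> {g' x..g' z}"
    by simp
  moreover have "connected (g' ` {0..1})"
    by (intro connected_continuous_image continuous_g') simp
  ultimately have "0 \<in> g' ` {0..1}"
    using connected_contains_Icc[of "g' ` {0..1}" "g' x" "g' z"] assms z(1) by blast
  then show False
    using g'_nonzero by auto
qed

lemma g_less:
  assumes "0 \<le> a" "a < b" "b \<le> 1"
  shows "g a < g b"
proof -
  obtain x where x: "x \<in> {a..b}" "g b - g a = g' x * (b - a)"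
    using g_mean_value[of a b] assms by auto
  have "0 < g' x * (b - a)"
    using g'_pos[of x] x(1) assms by (intro mult_pos_pos) auto
  then show ?thesis
    using x(2) by linarith
qed

lemma g_le:
  "0 \<le> a \<Longrightarrow> a \<le> b \<Longrightarrow> b \<le> 1 \<Longrightarrow> g a \<le> g b"
  using g_less[of a b] by (cases "a = b") auto

lemma g_inj: "inj_on g {0..1}"
  by (rule linorder_inj_onI') (use g_less in fastforce)

text \<open>An interior maximum of \<open>g'\<close> would be a zero of \<open>g''\<close>.\<close>

lemma g'_le_endpoints:
  assumes "0 \<le> a" "a \<le> x" "x \<le> b" "b \<le> 1"
  shows "g' x \<le> max \<bar>g' a\<bar> \<bar>g' b\<bar>"
proof -
  have cont: "continuous_on {a..b} g'"
    using assms by (intro continuous_on_subset[OF continuous_g']) auto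
  obtain c where c: "c \<in> {a..b}" "\<And>y. y \<in> {a..b} \<Longrightarrow> g' y \<le> g' c"
    using continuous_attains_sup[OF compact_Icc _ cont] assms by fastforce
  have "c = a \<or> c = b"
  proof (rule ccontr)
    assume "\<not> (c = a \<or> c = b)"
    with c(1) have ab: "a < c" "c < b" by auto
    with assms have "c \<in> {0<..<1}" by auto
    then have "(g' has_real_derivative nth_deriv {0..1} 2 g c) (at c)"
      using g'_has_derivative[of c] at_within_interior[of c "{0..1::real}"]
      by simp
    then have "nth_deriv {0..1} 2 g c = 0"
    proof (rule DERIV_local_max)
      show "0 < min (c - a) (b - c)" using ab by simp
      show "\<forall>y. \<bar>c - y\<bar> < min (c - a) (b - c) \<longrightarrow> g' y \<le> g' c"
        using c(2) by (intro allI impI c(2)) auto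
    qed
    then show False
      using g''_nonzero \<open>c \<in> {0<..<1}\<close> by blast
  qed
  moreover have "g' x \<le> g' c"
    using c(2)[of x] assms by simp
  ultimately show ?thesis by auto
qed

lemma g'_le_max_norm: "x \<in> {0..1} \<Longrightarrow> \<bar>g' x\<bar> \<le> max_norm_on {0..1} g'"
  using norm_le_max_norm_on[OF compact_Icc continuous_g'] by simp

lemma max_norm_g'_nonneg: "0 \<le> max_norm_on {0..1} g'"
  using g'_le_max_norm[of 0] abs_ge_zero[of "g' 0"] by (auto intro: order_trans)

lemma Ck_norm_Psi_nonneg: "0 \<le> Ck_norm k {g 0..g 1} (Psi f g)"
proof (rule order_trans[OF norm_ge_zero])
  show "norm (nth_deriv {g 0..g 1} 0 (Psi f g) (g 0)) \<le> Ck_norm k {g 0..g 1} (Psi f g)"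
    using g_le[of 0 1] by (intro norm_nth_deriv_le_Ck_norm Psi_smooth) auto
qed

lemma g_diff_le_max_norm:
  assumes "0 \<le> a" "a \<le> b" "b \<le> 1"
  shows "g b - g a \<le> max_norm_on {0..1} g' * (b - a)"
proof -
  obtain x where x: "x \<in> {a..b}" "g b - g a = g' x * (b - a)"
    using g_mean_value[OF assms] by auto
  then have "g' x \<le> max_norm_on {0..1} g'"
    using g'_le_max_norm[of x] assms by auto
  then show ?thesis
    unfolding x(2) using assms by (intro mult_right_mono) auto
qed

text \<open>Meant for a uniform piece [c,d] of a graded panel [a,b]: the slope is controlled at the
  ends of the large panel, as in \<open>slope_bound\<close>.\<close>

lemma g_diff_le_endpoints:
  assumes "0 \<le> a" "a \<le> c" "c \<le> d" "d \<le> b" "b \<le> 1"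
  shows "g d - g c \<le> max \<bar>g' a\<bar> \<bar>g' b\<bar> * (d - c)"
proof -
  obtain x where x: "x \<in> {c..d}" "g d - g c = g' x * (d - c)"
    using g_mean_value[of c d] assms by auto
  then have "g' x \<le> max \<bar>g' a\<bar> \<bar>g' b\<bar>"
    using assms by (intro g'_le_endpoints) auto
  then show ?thesis
    unfolding x(2) using assms by (intro mult_right_mono) auto
qed

section \<open>The amplitude \<open>Psi\<close> and the change of variables\<close>

lemma Psi_has_derivative:
  assumes "y \<in> {g 0..g 1}"
  shows "(nth_deriv {g 0..g 1} j (Psi f g) has_vector_derivative nth_deriv {g 0..g 1} (Suc j) (Psi f g) y)
    (at y within {g 0..g 1})"
  using Psi_smooth assms by (intro nth_deriv_has_vector_derivative[of "Suc j"]) (auto simp: C_infinity_on_def)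

lemma continuous_Psi: "continuous_on {g 0..g 1} (Psi f g)"
  using Psi_smooth by (auto simp: C_infinity_on_def C_k_on_def nth_deriv.simps(1) dest: spec[of _ 0])

lemma continuous_osc: "continuous_on {g 0..g 1} (osc \<kappa>)"
  by (intro continuous_intros continuous_Psi)

lemma osc_integrable:
  assumes "0 \<le> a" "b \<le> 1" "a \<le> b"
  shows "osc \<kappa> integrable_on {g a..g b}"
  using assms g_le[of 0 a] g_le[of b 1]
  by (intro integrable_continuous_real continuous_on_subset[OF continuous_osc]) auto

text \<open>Substitution y = g(x): the quotient by \<open>g'\<close> in \<open>Psi\<close> cancels
  the Jacobian, and \<open>inv_into\<close> is undone by the injectivity of g.\<close>

lemma osc_integral_eq: "osc_integral \<kappa> f g = integral {g 0..g 1} (osc \<kappa>)"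
proof -
  have "((\<lambda>x. g' x *\<^sub>R osc \<kappa> (g x)) has_integral integral {g 0..g 1} (osc \<kappa>)) {0..1}"
    using g_le by (intro has_integral_substitution[where c = "g 0" and d = "g 1"] continuous_osc g_has_derivative) auto
  moreover have "g' x *\<^sub>R osc \<kappa> (g x) = f x * exp (\<i> * of_real (\<kappa> * g x))" if "x \<in> {0..1}" for x
    using g'_nonzero[OF that] inv_into_f_f[OF g_inj that]
    by (simp add: Psi_def scaleR_conv_of_real)
  ultimately have "((\<lambda>x. f x * exp (\<i> * of_real (\<kappa> * g x))) has_integral integral {g 0..g 1} (osc \<kappa>)) {0..1}"
    by (rule has_integral_eq[rotated])
  then show ?thesis
    unfolding osc_integral_def by (rule integral_unique)
qed

section \<open>Error on one panel and on a uniform subdivision\<close>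

text \<open>Any order K beyond m is allowed in the norm, so that panels of different degrees can
  share one norm. The last factor \<open>g b - g a\<close> is kept apart from the m-th power because
  it will be summed over panels.\<close>

lemma filon_error:
  assumes t: "admissible_nodes t" and ab: "0 \<le> a" "a < b" "b \<le> 1" and m: "1 \<le> m" "Suc m \<le> K"
    and \<kappa>: "\<kappa> > 0"
  shows "norm (integral {g a..g b} (osc \<kappa>) - filon t \<kappa> f g a b m)
    \<le> Ck_norm K {g 0..g 1} (Psi f g) * (g b - g a) ^ m / fact m * (g b - g a) / \<kappa>"
proof -
  let ?S = "{g 0..g 1}" and ?B = "Ck_norm K {g 0..g 1} (Psi f g)"
  define z where "z = (\<lambda>j. g (t a b m j))"
  define p where "p = interp_poly (Psi f g) m z"
  \<comment> \<open>\<open>R j\<close> is the j-th derivative of the remainder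
    \<open>Psi f g\<close> - p.\<close>
  define R where "R = (\<lambda>j y. nth_deriv ?S j (Psi f g) y - poly ((pderiv ^^ j) p) (of_real y))"
  have t_ends: "t a b m 0 = a" "t a b m m = b" and t_mono: "strict_mono_on {0..m} (t a b m)"
    using t ab m by (auto simp: admissible_nodes_def)
  have t_less: "t a b m i < t a b m j" if "i < j" "j \<le> m" for i j
    using strict_mono_onD[OF t_mono, of i j] that by auto
  have t_mem: "t a b m j \<in> {a..b}" if "j \<le> m" for j
    using t_less[of 0 j] t_less[of j m] t_ends ab that by (cases "j = 0"; cases "j = m") auto
  have inj: "inj_on z {0..m}"
  proof (rule linorder_inj_onI')
    fix i j assume "i \<in> {0..m}" "j \<in> {0..m}" "i < j"
    then show "z i \<noteq> z j"
      using g_less[of "t a b m i" "t a b m j"] t_less[of i j] t_mem[of i] t_mem[of j] ab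
      by (auto simp: z_def)
  qed
  have sub: "{g a..g b} \<subseteq> ?S"
    using g_le[of 0 a] g_le[of b 1] ab by auto
  have "z j \<in> {g a..g b}" if "j \<le> m" for j
    using g_le[of a "t a b m j"] g_le[of "t a b m j" b] t_mem[OF that] ab by (auto simp: z_def)
  then have zsub: "z ` {0..m} \<subseteq> {g a..g b}" by auto
  have R0: "R 0 y = 0" if "y \<in> z ` {0..m}" for y
    using interp_poly_correct(2)[OF inj] that by (auto simp: R_def p_def nth_deriv.simps(1))
  have der: "(R j has_vector_derivative R (Suc j) y) (at y within {g a..g b})" if "y \<in> {g a..g b}" for j y
  proof -
    have "((\<lambda>y. poly ((pderiv ^^ j) p) (of_real y)) has_vector_derivative poly ((pderiv ^^ Suc j) p) (of_real y))
        (at y within {g a..g b})"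
      by (rule has_vector_derivative_real_field) (auto intro: poly_DERIV)
    moreover have "(nth_deriv ?S j (Psi f g) has_vector_derivative nth_deriv ?S (Suc j) (Psi f g) y)
        (at y within {g a..g b})"
      using Psi_has_derivative[of y j] that sub
      by (intro has_vector_derivative_within_subset[OF _ sub]) auto
    ultimately show ?thesis
      unfolding R_def by (intro has_vector_derivative_diff)
  qed
  have "degree p \<le> m"
    unfolding p_def by (rule interp_poly_correct(1)[OF inj])
  \<comment> \<open>At order m + 1 the interpolant disappears, so \<open>R (Suc m)\<close> is a
    derivative of \<open>Psi f g\<close> alone.\<close>
  then have "(pderiv ^^ Suc m) p = 0"
    by (intro poly_eqI) (simp add: coeff_higher_pderiv coeff_eq_0 del: funpow.simps)
  then have "norm (R (Suc m) y) \<le> ?B" if "y \<in> {g a..g b}" for y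
    unfolding R_def using that sub m Psi_smooth
      norm_nth_deriv_le_Ck_norm[of ?S "Psi f g" y "Suc m" K]
    by (auto simp del: funpow.simps)
  then have R1: "norm (R 1 y) \<le> ?B * (g b - g a) ^ m / fact m" if "y \<in> {g a..g b}" for y
    using card_image[OF inj] zsub R0 that
    by (intro norm_deriv_le_of_zeros[of m "g a" "g b" R "z ` {0..m}"] der) auto
  \<comment> \<open>The first and last nodes are the ends of the panel; this removes the boundary
    terms of the integration by parts.\<close>
  have ends: "R 0 (g a) = 0" "R 0 (g b) = 0"
    using R0[of "g a"] R0[of "g b"] t_ends by (force simp: z_def)+
  have bound: "norm (integral {g a..g b} (\<lambda>y. R 0 y * exp (\<i> * of_real (\<kappa> * y))))
      \<le> ?B * (g b - g a) ^ m / fact m * (g b - g a) / \<kappa>"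
  proof (rule norm_oscillatory_integral_le[where r' = "R 1"])
    show "(R 0 has_vector_derivative R 1 y) (at y within {g a..g b})" if "y \<in> {g a..g b}" for y
      using der[OF that, of 0] by simp
  qed (use R1 ends \<kappa> g_le[of a b] ab in auto)
  have "(\<lambda>y. poly p (of_real y) * exp (\<i> * of_real (\<kappa> * y))) integrable_on {g a..g b}"
    by (intro integrable_continuous_real continuous_intros)
  then have "integral {g a..g b} (osc \<kappa>) - filon t \<kappa> f g a b m
      = integral {g a..g b} (\<lambda>y. osc \<kappa> y - poly p (of_real y) * exp (\<i> * of_real (\<kappa> * y)))"
    unfolding filon_def p_def z_def
    using ab by (intro integral_diff[symmetric] osc_integrable) auto
  also have "\<dots> = integral {g a..g b} (\<lambda>y. R 0 y * exp (\<i> * of_real (\<kappa> * y)))"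
    by (simp add: R_def nth_deriv.simps(1) left_diff_distrib)
  finally show ?thesis
    using bound by simp
qed

text \<open>In the bound for each piece only the m-th power of the image width is estimated, by that
  of b - a. The remaining width stays exact and telescopes, so the number N of pieces does not enter
  the bound.\<close>

lemma filon_uniform_error:
  assumes t: "admissible_nodes t" and ab: "0 \<le> a" "a < b" "b \<le> 1" and m: "1 \<le> m" "Suc m \<le> K"
    and \<kappa>: "\<kappa> > 0" and N: "N \<ge> 1" "max \<bar>g' a\<bar> \<bar>g' b\<bar> \<le> real N"
  shows "norm (integral {g a..g b} (osc \<kappa>) - filon_uniform t \<kappa> f g a b N m)
    \<le> Ck_norm K {g 0..g 1} (Psi f g) * ((b - a) ^ m / fact m) * (g b - g a) / \<kappa>"
proof -
  let ?B = "Ck_norm K {g 0..g 1} (Psi f g)"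
  let ?y = "uniform_pt a b N"
  have y_less: "?y (k - 1) < ?y k" if "k \<in> {1..N}" for k
    using that ab N by (intro uniform_pt_less) auto
  have y_mem: "?y k \<in> {a..b}" "?y (k - 1) \<in> {a..b}" if "k \<in> {1..N}" for k
    using that ab N by (auto intro!: uniform_pt_mem simp del: atLeastAtMost_iff simp: atLeastAtMost_iff[of k])
  have mono: "mono_on {0..N} (\<lambda>k. g (?y k))"
  proof (rule mono_onI)
    fix i j assume ij: "i \<in> {0..N}" "j \<in> {0..N}" "i \<le> j"
    then have "?y i \<le> ?y j"
      using uniform_pt_less[OF ab(2) _ N(1), of i j] by (cases "i = j") auto
    then show "g (?y i) \<le> g (?y j)"
      using uniform_pt_mem[OF ab(2) N(1), of i] uniform_pt_mem[OF ab(2) N(1), of j] ij ab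
      by (intro g_le) auto
  qed
  note B = Ck_norm_Psi_nonneg
  have split: "integral {g a..g b} (osc \<kappa>) = (\<Sum>k = 1..N. integral {g (?y (k - 1))..g (?y k)} (osc \<kappa>))"
    using integral_combine_sum[of "osc \<kappa>" "\<lambda>k. g (?y k)" N, OF _ mono] osc_integrable[of a b \<kappa>] ab
    unfolding uniform_pt_ends(1) uniform_pt_ends(2)[OF N(1)] by auto
  have panel: "norm (integral {g (?y (k - 1))..g (?y k)} (osc \<kappa>) - filon t \<kappa> f g (?y (k - 1)) (?y k) m)
      \<le> ?B * ((b - a) ^ m / fact m) / \<kappa> * (g (?y k) - g (?y (k - 1)))" if k: "k \<in> {1..N}" for k
  proof -
    have h0: "0 \<le> g (?y k) - g (?y (k - 1))"
      using g_le[of "?y (k - 1)" "?y k"] y_less[OF k] y_mem[OF k] ab by auto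
    \<comment> \<open>The slope is at most N and the piece has length (b - a)/N, so its image is no
      longer than the undivided panel.\<close>
    have "g (?y k) - g (?y (k - 1)) \<le> max \<bar>g' a\<bar> \<bar>g' b\<bar> * (?y k - ?y (k - 1))"
      using y_less[OF k] y_mem[OF k] ab by (intro g_diff_le_endpoints) auto
    also have "\<dots> \<le> real N * (?y k - ?y (k - 1))"
      using N y_less[OF k] by (intro mult_right_mono) auto
    also have "\<dots> = b - a"
      using k N by (simp add: uniform_pt_def field_simps of_nat_diff)
    finally have h1: "g (?y k) - g (?y (k - 1)) \<le> b - a" .
    have "norm (integral {g (?y (k - 1))..g (?y k)} (osc \<kappa>) - filon t \<kappa> f g (?y (k - 1)) (?y k) m)
        \<le> ?B * (g (?y k) - g (?y (k - 1))) ^ m / fact m * (g (?y k) - g (?y (k - 1))) / \<kappa>"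
      using y_less[OF k] y_mem[OF k] ab by (intro filon_error t m \<kappa>) auto
    also have "\<dots> \<le> ?B * (b - a) ^ m / fact m * (g (?y k) - g (?y (k - 1))) / \<kappa>"
      using h0 h1 B \<kappa> by (intro divide_right_mono mult_right_mono mult_left_mono power_mono) auto
    finally show ?thesis by simp
  qed
  have "norm (integral {g a..g b} (osc \<kappa>) - filon_uniform t \<kappa> f g a b N m)
      \<le> (\<Sum>k = 1..N. ?B * ((b - a) ^ m / fact m) / \<kappa> * (g (?y k) - g (?y (k - 1))))"
    unfolding split filon_uniform_def sum_subtractf[symmetric] by (intro sum_norm_le panel)
  also have "\<dots> = ?B * ((b - a) ^ m / fact m) / \<kappa> * (\<Sum>k = 1..N. g (?y k) - g (?y (k - 1)))"
    by (simp add: sum_distrib_left)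
  also have "(\<Sum>k = 1..N. g (?y k) - g (?y (k - 1))) = g b - g a"
    using sum_telescope''[of 0 N "\<lambda>k. g (?y k)"] N by (simp add: uniform_pt_ends)
  finally show ?thesis by simp
qed

end

section \<open>The graded partition\<close>

lemma graded_pt_0: "graded_pt \<kappa> n 0 = 0"
  by (simp add: graded_pt_def)

lemma graded_pt_n: "n \<ge> 2 \<Longrightarrow> \<kappa> > 1 \<Longrightarrow> graded_pt \<kappa> n n = 1"
  by (simp add: graded_pt_def)

lemma graded_pt_1: "\<kappa> > 1 \<Longrightarrow> graded_pt \<kappa> n 1 = 1 / \<kappa>"
  by (simp add: graded_pt_def powr_minus_divide)

lemma graded_pt_less:
  assumes "\<kappa> > 1" "n \<ge> 2" "i < j"
  shows "graded_pt \<kappa> n i < graded_pt \<kappa> n j"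
\<comment> \<open>Index 0 is the added point 0, outside the geometric sequence of the other
  points.\<close>
proof (cases "i = 0")
  case True
  then show ?thesis using assms by (simp add: graded_pt_def)
next
  case False
  have "(real i - 1) / (real n - 1) < (real j - 1) / (real n - 1)"
    using assms by (intro divide_strict_right_mono) auto
  then show ?thesis
    using assms False by (simp add: graded_pt_def)
qed

lemma graded_pt_mem:
  assumes "\<kappa> > 1" "n \<ge> 2" "j \<le> n"
  shows "graded_pt \<kappa> n j \<in> {0..1}"
  using graded_pt_less[OF assms(1,2), of 0 j] graded_pt_less[OF assms(1,2), of j n] assms graded_pt_n[OF assms(2,1)]
  by (cases "j = 0"; cases "j = n") (auto simp: graded_pt_0)

section \<open>Degrees of the graded panels\<close>

lemma panel_degree_ge:
  "real n * (real n - 1) / (real n + 1 - real j) \<le> real (panel_degree n j)"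
  unfolding panel_degree_def by (rule real_nat_ceiling_ge)

lemma panel_degree_le:
  assumes "n \<ge> 1" "j \<le> n"
  shows "real (panel_degree n j) \<le> real n * (real n - 1) / (real n + 1 - real j) + 1"
proof -
  have "0 \<le> real n * (real n - 1) / (real n + 1 - real j)"
    using assms by (intro divide_nonneg_nonneg mult_nonneg_nonneg) auto
  then show ?thesis
    unfolding panel_degree_def by linarith
qed

text \<open>The denominator is at least 1, with equality for j = n. The order (n-1)n + 1 of the
  final norm is one more than this largest degree.\<close>

lemma panel_degree_le_square:
  assumes "n \<ge> 1" "j \<le> n"
  shows "panel_degree n j \<le> (n - 1) * n"
proof -
  have "real n * (real n - 1) / (real n + 1 - real j) \<le> real n * (real n - 1) / 1"
    using assms by (intro divide_left_mono mult_nonneg_nonneg) auto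
  also have "\<dots> = real ((n - 1) * n)"
    using assms by (simp add: of_nat_diff)
  finally show ?thesis
    unfolding panel_degree_def by (simp add: nat_le_iff ceiling_le_iff)
qed

lemma panel_degree_pos:
  assumes "n \<ge> 2" "j \<le> n"
  shows "panel_degree n j \<ge> 1"
proof -
  have "0 < real n * (real n - 1) / (real n + 1 - real j)"
    using assms by (intro divide_pos_pos mult_pos_pos) auto
  then have "0 < real (panel_degree n j)"
    using panel_degree_ge[of n j] by linarith
  then show ?thesis by simp
qed

text \<open>The quotient n(n-1)/n is an integer, so nothing is rounded. On the first panel this
  degree gives the power count for 1/\<kappa>.\<close>

lemma panel_degree_1:
  assumes "n \<ge> 1"
  shows "panel_degree n 1 = n - 1"
proof -
  have "real n * (real n - 1) / (real n + 1 - real 1) = real (n - 1)"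
    using assms by (simp add: of_nat_diff)
  then show ?thesis
    unfolding panel_degree_def by (simp only: ceiling_of_nat nat_int)
qed

lemma graded_panel_weight:
  assumes \<kappa>: "\<kappa> > 1" and j: "2 \<le> j" "j \<le> n" and n: "n \<ge> 3"
    and growth: "(real n - 1) * (ln (real n - 2 + exp 1) - 1) \<ge> ln \<kappa>"
  shows "(graded_pt \<kappa> n j - graded_pt \<kappa> n (j - 1)) ^ panel_degree n j / fact (panel_degree n j)
    \<le> \<kappa> powr (- real n) * (real n - 2) powr (-1/2)"
proof -
  define m where "m = panel_degree n j"
  define q where "q = real n + 1 - real j"
  define s where "s = \<kappa> powr (1 / (real n - 1))"
  have q: "1 \<le> q" "q \<le> real n - 1"
    using j by (auto simp: q_def)
  have mq: "real n * (real n - 1) \<le> q * real m"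
    using panel_degree_ge[of n j] q by (simp add: m_def q_def[symmetric] divide_le_eq mult.commute)
  \<comment> \<open>As j \<ge> 2 gives q \<le> n - 1, the degree is at least n; the comparisons of m
    with n - 2 below rest on this.\<close>
  have "q * real n \<le> q * real m"
    using mult_right_mono[OF q(2), of "real n"] mq by (simp add: mult.commute)
  then have mn: "n \<le> m"
    using q by simp
  \<comment> \<open>For j \<ge> 2 the left end is itself a member of the geometric sequence, not the
    special point 0.\<close>
  have x1: "graded_pt \<kappa> n (j - 1) = \<kappa> powr (- q / (real n - 1))"
  proof -
    have "(real (j - 1) - 1) / (real n - 1) - 1 = - q / (real n - 1)"
      using j n by (simp add: q_def of_nat_diff field_simps)
    then show ?thesis using j by (simp add: graded_pt_def)
  qed
  have x2: "graded_pt \<kappa> n j = \<kappa> powr (- q / (real n - 1)) * s"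
  proof -
    have "(real j - 1) / (real n - 1) - 1 = - q / (real n - 1) + 1 / (real n - 1)"
      using j n by (simp add: q_def field_simps)
    then have "graded_pt \<kappa> n j = \<kappa> powr (- q / (real n - 1) + 1 / (real n - 1))"
      using j by (simp add: graded_pt_def)
    then show ?thesis by (simp only: powr_add s_def)
  qed
  have pos: "0 < real n - 2 + exp 1"
    using n by (intro add_nonneg_pos) auto
  have "s \<ge> 1"
    using \<kappa> n by (simp add: s_def ge_one_powr_ge_zero)
  have "ln s = ln \<kappa> / (real n - 1)"
    using \<kappa> by (simp add: s_def ln_powr)
  also have "\<dots> \<le> ln (real n - 2 + exp 1) - 1"
    using growth n by (simp add: divide_le_eq mult.commute)
  also have "\<dots> = ln ((real n - 2 + exp 1) / exp 1)"
    using pos by (subst ln_div) auto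
  finally have "s \<le> (real n - 2 + exp 1) / exp 1"
    using \<open>s \<ge> 1\<close> pos by (subst (asm) ln_le_cancel_iff) auto
  then have s: "s - 1 \<le> (real n - 2) / exp 1"
    by (simp add: add_divide_distrib)
  \<comment> \<open>Stirling's bound is taken at the degree m, hence the passage from n - 2 to
    m.\<close>
  have "s - 1 \<le> real m / exp 1"
    using mn by (intro order_trans[OF s] divide_right_mono) auto
  then have "(s - 1) ^ m / fact m \<le> (real m / exp 1) ^ m / fact m"
    using \<open>s \<ge> 1\<close> by (intro divide_right_mono power_mono) auto
  also have "\<dots> \<le> 1 / sqrt (real m)"
    using fact_ge_sqrt_powr[of m] mn n by (simp add: field_simps)
  also have "\<dots> \<le> 1 / sqrt (real n - 2)"
    using mn n by (intro divide_left_mono) auto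
  also have "\<dots> = (real n - 2) powr (-1/2)"
    using n by (simp add: powr_minus_divide powr_half_sqrt)
  finally have w: "(s - 1) ^ m / fact m \<le> (real n - 2) powr (-1/2)" .
  have "(\<kappa> powr (- q / (real n - 1))) ^ m = \<kappa> powr (- (q * real m / (real n - 1)))"
    using \<kappa> by (simp add: powr_powr flip: powr_realpow)
  \<comment> \<open>A panel farther from 0 has a smaller q, hence a weaker power of \<kappa> per
    factor; its larger degree makes up for this.\<close>
  also have "\<dots> \<le> \<kappa> powr (- real n)"
    using mq \<kappa> n by (intro powr_mono) (simp_all add: le_divide_eq)
  finally have k: "(\<kappa> powr (- q / (real n - 1))) ^ m \<le> \<kappa> powr (- real n)" .
  have "graded_pt \<kappa> n j - graded_pt \<kappa> n (j - 1) = \<kappa> powr (- q / (real n - 1)) * (s - 1)"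
    unfolding x1 x2 by (simp add: algebra_simps)
  then have "(graded_pt \<kappa> n j - graded_pt \<kappa> n (j - 1)) ^ m / fact m
      = (\<kappa> powr (- q / (real n - 1))) ^ m * ((s - 1) ^ m / fact m)"
    by (simp add: power_mult_distrib)
  also have "\<dots> \<le> \<kappa> powr (- real n) * (real n - 2) powr (-1/2)"
    using k w \<open>s \<ge> 1\<close> by (intro mult_mono) auto
  finally show ?thesis unfolding m_def .
qed

text \<open>For n = 1 the first factor vanishes, for n = 2 the second, since ln e = 1; but ln
  \<kappa> is positive.\<close>

lemma growth_imp_ge_3:
  assumes "\<kappa> > 1" "n \<ge> 1" "(real n - 1) * (ln (real n - 2 + exp 1) - 1) \<ge> ln \<kappa>"
  shows "n \<ge> 3"
proof (rule ccontr)
  assume "\<not> n \<ge> 3"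
  with assms have "n = 1 \<or> n = 2" by auto
  moreover have "ln \<kappa> > 0" using assms by simp
  ultimately show False using assms(3) by auto
qed

section \<open>The composite rule\<close>

context filon_phase
begin

section \<open>Panel counts and the total error\<close>

lemma slope_bound_pos:
  assumes "\<kappa> > 1" "n \<ge> 2" "j \<le> n"
  shows "0 < slope_bound \<kappa> g n j"
  using g'_pos[OF graded_pt_mem[OF assms]] by (simp add: slope_bound_def less_max_iff_disj)

lemma panel_count_pos:
  assumes "\<kappa> > 1" "n \<ge> 2" "j \<le> n"
  shows "panel_count \<kappa> g n j \<ge> 1"
  using slope_bound_pos[OF assms] unfolding panel_count_def by linarith

lemma slope_bound_le_panel_count: "slope_bound \<kappa> g n j \<le> real (panel_count \<kappa> g n j)"
  unfolding panel_count_def by (rule real_nat_ceiling_ge)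

lemma panel_count_le:
  assumes "\<kappa> > 1" "n \<ge> 2" "j \<le> n"
  shows "real (panel_count \<kappa> g n j) \<le> real_of_int \<lceil>max_norm_on {0..1} g'\<rceil>"
proof -
  have "slope_bound \<kappa> g n j \<le> max_norm_on {0..1} g'"
    using g'_le_max_norm[of "graded_pt \<kappa> n j"] g'_le_max_norm[of "graded_pt \<kappa> n (j - 1)"]
      graded_pt_mem[OF assms(1,2), of j] graded_pt_mem[OF assms(1,2), of "j - 1"] assms
    by (auto simp: slope_bound_def)
  then have "\<lceil>slope_bound \<kappa> g n j\<rceil> \<le> \<lceil>max_norm_on {0..1} g'\<rceil>"
    by (rule ceiling_mono)
  moreover have "0 \<le> \<lceil>slope_bound \<kappa> g n j\<rceil>"
    using slope_bound_pos[OF assms] by simp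
  ultimately show ?thesis
    unfolding panel_count_def by simp
qed

text \<open>The last factor is a weight prepared for summation. For j \<ge> 2 it is the length of
  the panel; for j = 1 the length 1/\<kappa> is spent on completing the power \<kappa>^(-n), and 1
  is left.\<close>

lemma graded_panel_error:
  assumes \<kappa>: "\<kappa> > 1" and j: "1 \<le> j" "j \<le> n" and n: "n \<ge> 3" and t: "admissible_nodes t"
    and growth: "(real n - 1) * (ln (real n - 2 + exp 1) - 1) \<ge> ln \<kappa>"
  defines "a \<equiv> graded_pt \<kappa> n (j - 1)" and "b \<equiv> graded_pt \<kappa> n j"
  shows "norm (integral {g a..g b} (osc \<kappa>)
      - filon_uniform t \<kappa> f g a b (panel_count \<kappa> g n j) (panel_degree n j))
    \<le> Ck_norm ((n - 1) * n + 1) {g 0..g 1} (Psi f g) * max_norm_on {0..1} g' * (real n - 2) powr (-1/2)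
      * \<kappa> powr (- real n - 1) * (if j = 1 then 1 else b - a)"
proof -
  let ?B = "Ck_norm ((n - 1) * n + 1) {g 0..g 1} (Psi f g)"
  let ?\<sigma> = "max_norm_on {0..1} g'" and ?m = "panel_degree n j"
  let ?W = "(real n - 2) powr (-1/2)"
  have ab: "0 \<le> a" "a < b" "b \<le> 1"
    unfolding a_def b_def using graded_pt_mem[of \<kappa> n "j - 1"] graded_pt_mem[of \<kappa> n j] \<kappa> n j
    by (auto intro: graded_pt_less)
  note B = Ck_norm_Psi_nonneg and \<sigma> = max_norm_g'_nonneg
  have "norm (integral {g a..g b} (osc \<kappa>) - filon_uniform t \<kappa> f g a b (panel_count \<kappa> g n j) ?m)
      \<le> ?B * ((b - a) ^ ?m / fact ?m) * (g b - g a) / \<kappa>"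
    using ab panel_degree_pos[of n j] panel_degree_le_square[of n j] panel_count_pos[OF \<kappa>, of n j]
      slope_bound_le_panel_count[of \<kappa> n j] n j \<kappa>
    by (intro filon_uniform_error t) (auto simp: slope_bound_def a_def b_def)
  \<comment> \<open>The width that was kept apart brings in the maximal slope, and a factor b -
    a.\<close>
  also have "\<dots> \<le> ?B * ((b - a) ^ ?m / fact ?m) * (?\<sigma> * (b - a)) / \<kappa>"
    using g_diff_le_max_norm[of a b] ab B \<kappa> by (intro divide_right_mono mult_left_mono mult_nonneg_nonneg) auto
  also have "\<dots> = ?B * ?\<sigma> / \<kappa> * ((b - a) ^ ?m / fact ?m * (b - a))"
    by (simp add: mult_ac)
  also have "\<dots> \<le> ?B * ?\<sigma> / \<kappa> * (\<kappa> powr (- real n) * ?W * (if j = 1 then 1 else b - a))"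
  proof (intro mult_left_mono)
    show "(b - a) ^ ?m / fact ?m * (b - a) \<le> \<kappa> powr (- real n) * ?W * (if j = 1 then 1 else b - a)"
    proof (cases "j = 1")
      case False
      then have "(b - a) ^ ?m / fact ?m \<le> \<kappa> powr (- real n) * ?W"
        unfolding a_def b_def using \<kappa> j n growth by (intro graded_panel_weight) auto
      then have "(b - a) ^ ?m / fact ?m * (b - a) \<le> \<kappa> powr (- real n) * ?W * (b - a)"
        using ab by (intro mult_right_mono) auto
      then show ?thesis using False by simp
    next
      case True
      then have ba: "b - a = 1 / \<kappa>"
        using graded_pt_1[OF \<kappa>, of n] by (simp add: a_def b_def graded_pt_0)
      have m: "?m = n - 1"
        using panel_degree_1[of n] True n by simp
      \<comment> \<open>On the first panel no Stirling bound is needed: (n-1)! \<ge> n - 1 \<ge>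
        sqrt(n-2).\<close>
      have "sqrt (real n - 2) \<le> sqrt ((real n - 1)\<^sup>2)"
        using n by (intro real_sqrt_le_mono)
          (auto simp: power2_eq_square intro: order_trans[OF _ mult_mono[of 1 _ "real n - 1"]])
      also have "\<dots> = real (n - 1)"
        using n by (simp add: of_nat_diff)
      also have "\<dots> \<le> fact (n - 1)"
        using fact_ge_self[of "n - 1"] by (metis of_nat_fact of_nat_le_iff)
      finally have "1 / fact (n - 1) \<le> 1 / sqrt (real n - 2)"
        using n by (intro divide_left_mono) auto
      also have "\<dots> = ?W"
        using n by (simp add: powr_minus_divide powr_half_sqrt)
      finally have W: "1 / fact (n - 1) \<le> ?W" .
      \<comment> \<open>There are n factors 1/\<kappa>: n - 1 from the interpolation remainder and
        one from the length of the panel.\<close>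
      have "(b - a) ^ ?m / fact ?m * (b - a) = (1 / \<kappa>) ^ Suc (n - 1) * (1 / fact (n - 1))"
        unfolding ba m by simp
      also have "(1 / \<kappa>) ^ Suc (n - 1) = \<kappa> powr (- real n)"
        using \<kappa> n by (simp add: powr_minus_divide powr_realpow power_one_over del: power_Suc)
      also have "\<dots> * (1 / fact (n - 1)) \<le> \<kappa> powr (- real n) * ?W"
        using W by (intro mult_left_mono) auto
      finally show ?thesis using True by simp
    qed
    show "0 \<le> ?B * ?\<sigma> / \<kappa>" using B \<sigma> \<kappa> by simp
  qed
  also have "\<dots> = ?B * ?\<sigma> * ?W * (\<kappa> powr (- real n) / \<kappa>) * (if j = 1 then 1 else b - a)"
    by simp
  also have "\<kappa> powr (- real n) / \<kappa> = \<kappa> powr (- real n - 1)"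
    using \<kappa> by (simp add: powr_diff)
  finally show ?thesis by simp
qed

theorem composite_filon_error:
  assumes \<kappa>: "\<kappa> > 1" and n: "n \<ge> 3" and t: "admissible_nodes t"
    and growth: "(real n - 1) * (ln (real n - 2 + exp 1) - 1) \<ge> ln \<kappa>"
  shows "norm (osc_integral \<kappa> f g - composite_filon t \<kappa> n f g)
    \<le> 2 * max_norm_on {0..1} g' * (real n - 2) powr (-1/2) * \<kappa> powr (- real n - 1)
      * Ck_norm ((n - 1) * n + 1) {g 0..g 1} (Psi f g)"
proof -
  let ?x = "graded_pt \<kappa> n"
  define E where "E = Ck_norm ((n - 1) * n + 1) {g 0..g 1} (Psi f g) * max_norm_on {0..1} g'
    * (real n - 2) powr (-1/2) * \<kappa> powr (- real n - 1)"
  have mono: "mono_on {0..n} (\<lambda>k. g (?x k))"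
  proof (rule mono_onI)
    fix i j assume ij: "i \<in> {0..n}" "j \<in> {0..n}" "i \<le> j"
    then have "?x i \<le> ?x j"
      using graded_pt_less[OF \<kappa>, of n i j] n by (cases "i = j") auto
    then show "g (?x i) \<le> g (?x j)"
      using graded_pt_mem[OF \<kappa>, of n i] graded_pt_mem[OF \<kappa>, of n j] ij n by (intro g_le) auto
  qed
  have ends: "?x 0 = 0" "?x n = 1"
    using n \<kappa> by (auto simp: graded_pt_0 graded_pt_n)
  have split: "osc_integral \<kappa> f g = (\<Sum>k = 1..n. integral {g (?x (k - 1))..g (?x k)} (osc \<kappa>))"
    using integral_combine_sum[of "osc \<kappa>" "\<lambda>k. g (?x k)" n, OF _ mono] osc_integrable[of 0 1 \<kappa>]
    unfolding osc_integral_eq ends by auto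
  \<comment> \<open>The constant 2 arises here: weight 1 from the first panel, and lengths of the
    others that telescope to at most 1.\<close>
  have sum_weights: "(\<Sum>k = 1..n. if k = 1 then 1 else ?x k - ?x (k - 1)) \<le> 2"
  proof -
    have "(\<Sum>k = 1..n. if k = 1 then 1 else ?x k - ?x (k - 1)) = 1 + (\<Sum>k = 2..n. ?x k - ?x (k - 1))"
      using n by (subst sum.atLeast_Suc_atMost) (auto simp: numeral_2_eq_2 intro!: sum.cong)
    also have "(\<Sum>k = 2..n. ?x k - ?x (k - 1)) = ?x n - ?x 1"
      using sum_telescope''[of 1 n ?x] n by (simp add: numeral_2_eq_2)
    also have "?x n - ?x 1 \<le> 1"
      using graded_pt_mem[OF \<kappa>, of n 1] n ends by simp
    finally show ?thesis by simp
  qed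
  have E: "0 \<le> E"
    unfolding E_def by (intro mult_nonneg_nonneg Ck_norm_Psi_nonneg max_norm_g'_nonneg) auto
  have "norm (osc_integral \<kappa> f g - composite_filon t \<kappa> n f g)
      \<le> (\<Sum>k = 1..n. E * (if k = 1 then 1 else ?x k - ?x (k - 1)))"
    unfolding split composite_filon_def sum_subtractf[symmetric]
  proof (intro sum_norm_le)
    fix k assume "k \<in> {1..n}"
    then show "norm (integral {g (?x (k - 1))..g (?x k)} (osc \<kappa>)
        - filon_uniform t \<kappa> f g (?x (k - 1)) (?x k) (panel_count \<kappa> g n k) (panel_degree n k))
        \<le> E * (if k = 1 then 1 else ?x k - ?x (k - 1))"
      unfolding E_def using \<kappa> n t growth by (intro graded_panel_error) auto
  qed
  also have "\<dots> = E * (\<Sum>k = 1..n. if k = 1 then 1 else ?x k - ?x (k - 1))"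
    by (simp add: sum_distrib_left)
  also have "\<dots> \<le> E * 2"
    using sum_weights E by (rule mult_left_mono)
  finally show ?thesis
    by (simp add: E_def mult_ac)
qed

section \<open>Counting the evaluation points\<close>

text \<open>Each panel is charged for all of its nodes but the first, which is the last node of
  its predecessor.\<close>

lemma filon_uniform_points_subset:
  assumes t: "admissible_nodes t" and ab: "0 \<le> a" "a < b" "b \<le> 1" and m: "m \<ge> 1" and N: "N \<ge> 1"
  defines "P \<equiv> \<Union>k\<in>{1..N}. (\<lambda>i. g (t (uniform_pt a b N (k - 1)) (uniform_pt a b N k) m i)) ` {1..m}"
  shows "filon_uniform_points t g a b N m \<subseteq> insert (g a) P" and "g b \<in> P"
proof -
  let ?y = "uniform_pt a b N"
  have ends: "t (?y (k - 1)) (?y k) m 0 = ?y (k - 1)" "t (?y (k - 1)) (?y k) m m = ?y k" if "k \<in> {1..N}" for k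
  proof -
    have "?y (k - 1) < ?y k"
      using that ab N by (intro uniform_pt_less) auto
    moreover have "?y (k - 1) \<in> {a..b}" "?y k \<in> {a..b}"
      using that uniform_pt_mem[OF ab(2) N, of k] uniform_pt_mem[OF ab(2) N, of "k - 1"]
      unfolding atLeastAtMost_iff[of k] by (meson diff_le_self le_trans)+
    ultimately show "t (?y (k - 1)) (?y k) m 0 = ?y (k - 1)" "t (?y (k - 1)) (?y k) m m = ?y k"
      using t ab m by (auto simp: admissible_nodes_def)
  qed
  have right: "g (?y k) \<in> P" if "k \<in> {1..N}" for k
    unfolding P_def using that ends(2)[OF that] m
    by (intro UN_I[OF that] image_eqI[of _ _ m]) auto
  \<comment> \<open>This lets the next graded panel find its first point among the points charged to
    this one.\<close>
  show "g b \<in> P"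
    using right[of N] N uniform_pt_ends(2)[OF N, of a b] by simp
  show "filon_uniform_points t g a b N m \<subseteq> insert (g a) P"
  proof
    fix y assume "y \<in> filon_uniform_points t g a b N m"
    then obtain k i where k: "k \<in> {1..N}" and i: "i \<in> {0..m}" and y: "y = g (t (?y (k - 1)) (?y k) m i)"
      by (auto simp: filon_uniform_points_def filon_points_def)
    show "y \<in> insert (g a) P"
    proof (cases "i = 0")
      case False
      with k i y show ?thesis by (force simp: P_def)
    next
      case True
      then have "y = g (?y (k - 1))"
        using y ends(1)[OF k] by simp
      moreover have "k = 1 \<or> k - 1 \<in> {1..N}"
        using k by auto
      ultimately show ?thesis
        using right[of "k - 1"] uniform_pt_ends(1)[of a b N] by (elim disjE) auto
    qed
  qed
qed

text \<open>Chaining the graded panels leaves \<open>g 0\<close> as the only point charged to none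
  of them, whence the final 1. All other points number at most the sum of the products N_j
  m_j.\<close>

theorem num_evals_le:
  assumes \<kappa>: "\<kappa> > 1" and n: "n \<ge> 2" and t: "admissible_nodes t"
  shows "real (num_evals t \<kappa> n g)
    \<le> real_of_int \<lceil>max_norm_on {0..1} g'\<rceil> * (real n * (real n - 1) * ln (real n) + (real n)\<^sup>2) + 1"
proof -
  let ?x = "graded_pt \<kappa> n" and ?N = "panel_count \<kappa> g n" and ?m = "panel_degree n"
  let ?\<sigma> = "real_of_int \<lceil>max_norm_on {0..1} g'\<rceil>"
  define P where "P = (\<lambda>j. \<Union>k\<in>{1..?N j}. (\<lambda>i. g (t (uniform_pt (?x (j - 1)) (?x j) (?N j) (k - 1))
      (uniform_pt (?x (j - 1)) (?x j) (?N j) k) (?m j) i)) ` {1..?m j})"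
  have ab: "0 \<le> ?x (j - 1)" "?x (j - 1) < ?x j" "?x j \<le> 1" if "j \<in> {1..n}" for j
    using that graded_pt_mem[OF \<kappa> n, of j] graded_pt_mem[OF \<kappa> n, of "j - 1"]
      graded_pt_less[OF \<kappa> n, of "j - 1" j]
    by auto
  have sub: "filon_uniform_points t g (?x (j - 1)) (?x j) (?N j) (?m j) \<subseteq> insert (g (?x (j - 1))) (P j)"
    and right: "g (?x j) \<in> P j" if "j \<in> {1..n}" for j
    using filon_uniform_points_subset[OF t ab[OF that] panel_degree_pos[OF n] panel_count_pos[OF \<kappa> n], of j j] that
    unfolding P_def by auto
  have "g (?x (j - 1)) \<in> insert (g 0) (\<Union>j\<in>{1..n}. P j)" if "j \<in> {1..n}" for j
  proof (cases "j = 1")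
    case False
    with that have "j - 1 \<in> {1..n}" by auto
    then show ?thesis using right[of "j - 1"] by blast
  qed (simp add: graded_pt_0)
  then have "composite_filon_points t \<kappa> n g \<subseteq> insert (g 0) (\<Union>j\<in>{1..n}. P j)"
    unfolding composite_filon_points_def using sub by blast
  then have "num_evals t \<kappa> n g \<le> card (insert (g 0) (\<Union>j\<in>{1..n}. P j))"
    unfolding num_evals_def by (rule card_mono[rotated]) (auto simp: P_def)
  also have "\<dots> \<le> Suc (card (\<Union>j\<in>{1..n}. P j))"
    by (rule card_insert_le_m1[THEN order_trans]) auto
  also have "card (\<Union>j\<in>{1..n}. P j) \<le> (\<Sum>j = 1..n. card (P j))"
    by (rule card_UN_le) simp
  also have "(\<Sum>j = 1..n. card (P j)) \<le> (\<Sum>j = 1..n. ?N j * ?m j)"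
  proof (rule sum_mono)
    fix j
    have "card (P j) \<le> (\<Sum>k = 1..?N j. card ((\<lambda>i. g (t (uniform_pt (?x (j - 1)) (?x j) (?N j) (k - 1))
      (uniform_pt (?x (j - 1)) (?x j) (?N j) k) (?m j) i)) ` {1..?m j}))"
      unfolding P_def by (rule card_UN_le) simp
    also have "\<dots> \<le> (\<Sum>k = 1..?N j. ?m j)"
      by (intro sum_mono order_trans[OF card_image_le]) auto
    finally show "card (P j) \<le> ?N j * ?m j" by simp
  qed
  finally have "real (num_evals t \<kappa> n g) \<le> real (Suc (\<Sum>j = 1..n. ?N j * ?m j))"
    by (simp only: of_nat_le_iff)
  also have "\<dots> = (\<Sum>j = 1..n. real (?N j) * real (?m j)) + 1"
    by simp
  \<comment> \<open>Rounding up costs at most 1 per degree, n in all. With the 1 from the harmonic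
    bound, n(n-1) + n becomes the n^2 of the claim.\<close>
  also have "(\<Sum>j = 1..n. real (?N j) * real (?m j))
      \<le> (\<Sum>j = 1..n. ?\<sigma> * (real n * (real n - 1) / (real n + 1 - real j) + 1))"
    using panel_count_le[OF \<kappa> n] panel_degree_le[of n] max_norm_g'_nonneg n
    by (intro sum_mono mult_mono) auto
  also have "\<dots> = ?\<sigma> * (real n * (real n - 1) * (\<Sum>j = 1..n. inverse (real n + 1 - real j)) + real n)"
    by (simp add: sum.distrib divide_inverse flip: sum_distrib_left)
  also have "(\<Sum>j = 1..n. inverse (real n + 1 - real j)) = harm n"
    unfolding harm_def
    by (rule sum.reindex_bij_witness[of _ "\<lambda>i. n + 1 - i" "\<lambda>i. n + 1 - i"]) (auto simp: of_nat_diff)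
  also have "?\<sigma> * (real n * (real n - 1) * harm n + real n)
      \<le> ?\<sigma> * (real n * (real n - 1) * (ln (real n) + 1) + real n)"
    using harm_le_ln_plus_one[of n] max_norm_g'_nonneg n
    by (intro mult_left_mono add_right_mono mult_nonneg_nonneg) auto
  also have "real n * (real n - 1) * (ln (real n) + 1) + real n = real n * (real n - 1) * ln (real n) + (real n)\<^sup>2"
    by (simp add: algebra_simps power2_eq_square)
  finally show ?thesis by simp
qed

end

theorem theorem3p5:
  fixes f :: "real \<Rightarrow> complex" and g :: "real \<Rightarrow> real" and \<sigma> :: real
  assumes "C_k_on 2 {0..1} f"
    and "C_k_on 2 {0..1} g"
    and "mono_on {0..1} g"
    and "\<forall>x\<in>{0..1}. nth_deriv {0..1} 1 g x \<noteq> 0"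
    and "\<forall>x\<in>{0<..<1}. nth_deriv {0..1} 2 g x \<noteq> 0"
    and "\<sigma> = max_norm_on {0..1} (nth_deriv {0..1} 1 g)"
    and "C_infinity_on {g 0..g 1} (Psi f g)"
  shows "(\<exists>c>0. \<forall>(\<kappa>::real) (n::nat) t.
            \<kappa> > 1 \<and> n \<ge> 1 \<and> admissible_nodes t \<and>
            (real n - 1) * (ln (real n - 2 + exp 1) - 1) \<ge> ln \<kappa> \<longrightarrow>
            norm (osc_integral \<kappa> f g - composite_filon t \<kappa> n f g)
              \<le> c * \<sigma> * (real n - 2) powr (-1/2) * \<kappa> powr (- real n - 1)
                  * Ck_norm ((n - 1) * n + 1) {g 0..g 1} (Psi f g))
       \<and> (\<forall>(\<kappa>::real) (n::nat) t.
            \<kappa> > 1 \<and> n > 2 \<and> admissible_nodes t \<longrightarrow>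
            real (num_evals t \<kappa> n g)
              \<le> real_of_int \<lceil>\<sigma>\<rceil> * (real n * (real n - 1) * ln (real n) + (real n)\<^sup>2) + 1)"
proof -
  interpret filon_phase f g
    using assms by unfold_locales auto
  show ?thesis
  proof (intro conjI exI[of _ "2::real"] allI impI)
    fix \<kappa> :: real and n :: nat and t
    assume h: "\<kappa> > 1 \<and> n \<ge> 1 \<and> admissible_nodes t \<and>
      (real n - 1) * (ln (real n - 2 + exp 1) - 1) \<ge> ln \<kappa>"
    \<comment> \<open>This excludes n = 2, for which \<open>0 powr (-1/2) = 0\<close> would make the
      bound vanish.\<close>
    then have "n \<ge> 3"
      using growth_imp_ge_3 by blast
    with h show "norm (osc_integral \<kappa> f g - composite_filon t \<kappa> n f g)
        \<le> 2 * \<sigma> * (real n - 2) powr (-1/2) * \<kappa> powr (- real n - 1)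
          * Ck_norm ((n - 1) * n + 1) {g 0..g 1} (Psi f g)"
      unfolding assms(6) by (intro composite_filon_error) auto
  next
    fix \<kappa> :: real and n :: nat and t
    assume "\<kappa> > 1 \<and> n > 2 \<and> admissible_nodes t"
    then show "real (num_evals t \<kappa> n g)
        \<le> real_of_int \<lceil>\<sigma>\<rceil> * (real n * (real n - 1) * ln (real n) + (real n)\<^sup>2) + 1"
      unfolding assms(6) by (intro num_evals_le) auto
  qed simp
qed

end
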